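(* For each integer $d\ge 8$ there exist an $\varepsilon>0$ and a function $g:\mathbb{R}\to\mathbb{R}$ satisfying $$g\in C^\infty(\mathbb{R}),\quad g \text{ is odd},\quad g'(0)=1,\quad g>0 \text{ on } (0,\infty),$$ such that $$g(u)=u\sqrt{1+7u^2-(23d-170)u^4}\qquad\text{for } |u|<\phi_0(1)+\varepsilon,$$ and the manifold $N^d$ with metric $h=du^2+g(u)^2d\theta^2$ has all sectional curvatures negative.
   Context: Here $N^d=\mathbb{R}^+\times_g\mathbb{S}^{d-1}$ is the $d$-dimensional warped product manifold with natural polar coordinates $(u,\theta)\in\mathbb{R}^+\times\mathbb{S}^{d-1}$ and metric $h=du^2+g(u)^2d\theta^2$, where $d\theta^2$ is the standard metric on $\mathbb{S}^{d-1}$ ($u=0$ corresponds to the pole). For $d\ge 8$ define $$E(d)=\sqrt{(46d^2-291d-49)(d-1)}+7(d-1),\quad a=\sqrt{\frac{d}{E(d)}},\quad b=1+\frac d2-\frac{7d(d-1)}{E(d)},$$ $$\phi_0(\rho)=\frac{a\rho}{\sqrt{b-\rho^2}},\qquad \rho\in[0,1].$$ For $d\ge 8$ one has $E(d)>0$ and $b>1$, so $\phi_0$ is smooth on $[0,1]$; in particular $\phi_0(1)=a/\sqrt{b-1}$. *)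

theory Defs
  imports "HOL-Analysis.Analysis"
begin

definition C_infinity :: "(real \<Rightarrow> real) \<Rightarrow> bool" where
  "C_infinity g \<longleftrightarrow> (\<forall>k x. ((deriv ^^ k) g) differentiable (at x))"

definition E_const :: "nat \<Rightarrow> real" where
  "E_const d = sqrt ((46 * (real d)\<^sup>2 - 291 * real d - 49) * (real d - 1)) + 7 * (real d - 1)"

definition a_const :: "nat \<Rightarrow> real" where
  "a_const d = sqrt (real d / E_const d)"

definition b_const :: "nat \<Rightarrow> real" where
  "b_const d = 1 + real d / 2 - 7 * real d * (real d - 1) / E_const d"

definition phi0 :: "nat \<Rightarrow> real \<Rightarrow> real" where
  "phi0 d \<rho> = a_const d * \<rho> / sqrt (b_const d - \<rho>\<^sup>2)"

text \<open>
  Riemannian geometry in one global chart \<open>\<real>\<^sup>n\<close>. A metric \<open>h\<close> assigns to each point \<open>x\<close>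
  the bilinear form \<open>h x\<close> on the tangent space at \<open>x\<close>.
\<close>

type_synonym 'n metric_field = "real ^ 'n \<Rightarrow> real ^ 'n \<Rightarrow> real ^ 'n \<Rightarrow> real"

definition partial_deriv :: "'n::finite \<Rightarrow> (real ^ 'n \<Rightarrow> real) \<Rightarrow> real ^ 'n \<Rightarrow> real" where
  "partial_deriv i f x = deriv (\<lambda>t. f (x + t *\<^sub>R axis i 1)) 0"

definition gram :: "'n::finite metric_field \<Rightarrow> real ^ 'n \<Rightarrow> real ^ 'n ^ 'n" where
  "gram h x = (\<chi> i j. h x (axis i 1) (axis j 1))"

text \<open>Christoffel symbols of the Levi-Civita connection, \<open>\<Gamma>\<^sup>k\<close> with lower indices \<open>i j\<close>.\<close>

definition christoffel :: "'n::finite metric_field \<Rightarrow> 'n \<Rightarrow> 'n \<Rightarrow> 'n \<Rightarrow> real ^ 'n \<Rightarrow> real" where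
  "christoffel h k i j x =
     (1/2) * (\<Sum>l\<in>UNIV. matrix_inv (gram h x) $ k $ l *
       (partial_deriv i (\<lambda>y. gram h y $ j $ l) x
        + partial_deriv j (\<lambda>y. gram h y $ i $ l) x
        - partial_deriv l (\<lambda>y. gram h y $ i $ j) x))"

text \<open>
  The \<open>l\<close>-th component of \<open>R(\<partial>\<^sub>i,\<partial>\<^sub>j)\<partial>\<^sub>k\<close>, with
  \<open>R(X,Y) = \<nabla>\<^sub>X\<nabla>\<^sub>Y - \<nabla>\<^sub>Y\<nabla>\<^sub>X - \<nabla>\<^bsub>[X,Y]\<^esub>\<close>. With this sign the sectional curvature below
  is positive on round spheres.
\<close>

definition riemann_coeff ::
  "'n::finite metric_field \<Rightarrow> 'n \<Rightarrow> 'n \<Rightarrow> 'n \<Rightarrow> 'n \<Rightarrow> real ^ 'n \<Rightarrow> real" where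
  "riemann_coeff h l i j k x =
     partial_deriv i (christoffel h l j k) x - partial_deriv j (christoffel h l i k) x
     + (\<Sum>m\<in>UNIV. christoffel h l i m x * christoffel h m j k x
               - christoffel h l j m x * christoffel h m i k x)"

definition riemann ::
  "'n::finite metric_field \<Rightarrow> real ^ 'n \<Rightarrow> real ^ 'n \<Rightarrow> real ^ 'n \<Rightarrow> real ^ 'n \<Rightarrow> real ^ 'n" where
  "riemann h x v w z =
     (\<chi> l. \<Sum>i\<in>UNIV. \<Sum>j\<in>UNIV. \<Sum>k\<in>UNIV. riemann_coeff h l i j k x * (v $ i) * (w $ j) * (z $ k))"

definition sectional_curvature ::
  "'n::finite metric_field \<Rightarrow> real ^ 'n \<Rightarrow> real ^ 'n \<Rightarrow> real ^ 'n \<Rightarrow> real" where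
  "sectional_curvature h x v w =
     h x (riemann h x v w w) v / (h x v v * h x w w - (h x v w)\<^sup>2)"

definition negative_sectional_curvature :: "'n::finite metric_field \<Rightarrow> bool" where
  "negative_sectional_curvature h \<longleftrightarrow>
     (\<forall>x v w. v \<noteq> w \<and> independent {v, w} \<longrightarrow> sectional_curvature h x v w < 0)"

text \<open>
  The polar coordinates \<open>(u, \<theta>) \<mapsto> u \<theta>\<close> identify the warped product, together with its pole
  \<open>u = 0\<close>, with \<open>\<real>\<^sup>d\<close>. At \<open>x \<noteq> 0\<close> we have \<open>u = \<parallel>x\<parallel>\<close> and \<open>\<theta> = x / \<parallel>x\<parallel>\<close>; the differentials
  of these two maps at \<open>x\<close>, applied to \<open>v\<close>, are \<open>d_radius x v\<close> and \<open>d_angle x v\<close>. At the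
  pole, the metric \<open>du\<^sup>2 + g(u)\<^sup>2 d\<theta>\<^sup>2\<close> extends by the Euclidean inner product,
  because \<open>g(0) = 0\<close> and \<open>g'(0) = 1\<close>; the extension is smooth when \<open>g\<close> is moreover smooth and odd.
\<close>

definition d_radius :: "real ^ 'n::finite \<Rightarrow> real ^ 'n \<Rightarrow> real" where
  "d_radius x v = (x \<bullet> v) / norm x"

definition d_angle :: "real ^ 'n::finite \<Rightarrow> real ^ 'n \<Rightarrow> real ^ 'n" where
  "d_angle x v = (1 / norm x) *\<^sub>R (v - (d_radius x v / norm x) *\<^sub>R x)"

definition warped_metric :: "(real \<Rightarrow> real) \<Rightarrow> 'n::finite metric_field" where
  "warped_metric g x v w =
     (if x = 0 then v \<bullet> w
      else d_radius x v * d_radius x w + (g (norm x))\<^sup>2 * (d_angle x v \<bullet> d_angle x w))"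

lemma has_derivative_radius:
  assumes "x \<noteq> 0"
  shows "(norm has_derivative d_radius x) (at x)"
proof -
  have "(norm has_derivative (\<lambda>v. v \<bullet> sgn x)) (at x)"
    using assms by (rule has_derivative_norm)
  moreover have "(\<lambda>v. v \<bullet> sgn x) = d_radius x"
    by (auto simp: d_radius_def sgn_div_norm inner_commute divide_inverse)
  ultimately show ?thesis by simp
qed

lemma has_derivative_angle:
  assumes "x \<noteq> 0"
  shows "((\<lambda>y. (1 / norm y) *\<^sub>R y) has_derivative d_angle x) (at x)"
proof -
  have inv: "((\<lambda>y. inverse (norm y)) has_derivative
      (\<lambda>v. - (inverse (norm x) * d_radius x v * inverse (norm x)))) (at x)"
    using assms by (intro Deriv.has_derivative_inverse has_derivative_radius) auto
  have "((\<lambda>y. inverse (norm y) *\<^sub>R y) has_derivative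
      (\<lambda>v. inverse (norm x) *\<^sub>R v
        + (- (inverse (norm x) * d_radius x v * inverse (norm x))) *\<^sub>R x)) (at x)"
    by (rule has_derivative_scaleR[OF inv has_derivative_ident])
  moreover have "(\<lambda>v. inverse (norm x) *\<^sub>R v
        + (- (inverse (norm x) * d_radius x v * inverse (norm x))) *\<^sub>R x) = d_angle x"
    by (rule ext) (simp add: d_angle_def scaleR_diff_right divide_inverse mult_ac)
  ultimately show ?thesis by (simp add: inverse_eq_divide)
qed

text \<open>Pulled back along \<open>(u, \<theta>) \<mapsto> u \<theta>\<close>, the metric is \<open>du\<^sup>2 + g(u)\<^sup>2 d\<theta>\<^sup>2\<close>.\<close>

lemma warped_metric_polar:
  assumes "u > 0" "norm \<theta> = 1" "\<theta> \<bullet> \<sigma> = 0" "\<theta> \<bullet> \<tau> = 0"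
  shows "warped_metric g (u *\<^sub>R \<theta>) (\<alpha> *\<^sub>R \<theta> + u *\<^sub>R \<sigma>) (\<beta> *\<^sub>R \<theta> + u *\<^sub>R \<tau>) = \<alpha> * \<beta> + (g u)\<^sup>2 * (\<sigma> \<bullet> \<tau>)"
proof -
  have t: "\<theta> \<bullet> \<theta> = 1" using assms(2) by (simp add: norm_eq_1)
  have r: "d_radius (u *\<^sub>R \<theta>) (\<alpha> *\<^sub>R \<theta> + u *\<^sub>R \<sigma>) = \<alpha>" if "\<theta> \<bullet> \<sigma> = 0" for \<alpha> \<sigma>
    using assms(1,2) t that by (simp add: d_radius_def inner_add_right)
  have a: "d_angle (u *\<^sub>R \<theta>) (\<alpha> *\<^sub>R \<theta> + u *\<^sub>R \<sigma>) = \<sigma>" if "\<theta> \<bullet> \<sigma> = 0" for \<alpha> \<sigma>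
    using assms(1,2) by (simp add: d_angle_def r[OF that])
  have "u *\<^sub>R \<theta> \<noteq> 0" using assms(1,2) by auto
  then show ?thesis using assms by (simp add: warped_metric_def r a)
qed

end

theory Submission
  imports Defs
begin

text \<open>
  In coordinates \<open>x = u \<theta>\<close> the metric is \<open>A(s) (v \<bullet> w) + B(s) (x \<bullet> v) (x \<bullet> w)\<close> with
  \<open>s = \<parallel>x\<parallel>\<^sup>2\<close>, \<open>A(u\<^sup>2) = g(u)\<^sup>2 / u\<^sup>2\<close> and \<open>A + s B = 1\<close>, the last identity
  because radial lines have unit speed. A computation of the Christoffel symbols and of the
  curvature tensor from their definitions (\<open>metric_riemann\<close>) shows that, off the pole, every sectional
  curvature is a convex combination of the tangential curvature \<open>(1 - g'\<^sup>2) / g\<^sup>2\<close> and the radial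
  curvature \<open>- g'' / g\<close>. At the pole all curvatures equal \<open>3 B(0)\<close>. Hence
  (\<open>warped_metric_negative\<close>) the curvature is negative if \<open>g\<close>, \<open>g' - 1\<close> and \<open>g''\<close> are
  positive on the half line and \<open>B(0) < 0\<close>; here \<open>B(s) = - 7 + c s\<close> near \<open>0\<close>, with
  \<open>c = 23 d - 170\<close>.

  The prescribed profile \<open>G(u) = u \<surd>(F(u\<^sup>2))\<close> with \<open>F(s) = 1 + 7 s - c s\<^sup>2\<close> has
  \<open>G''(u) = u Q(u\<^sup>2) / F(u\<^sup>2)\<^bsup>3/2\<^esup>\<close> for a cubic polynomial \<open>Q\<close>. Both \<open>F\<close> and \<open>Q\<close>
  are positive on \<open>[0, s\<^sub>0]\<close>, where \<open>s\<^sub>0 = \<phi>\<^sub>0(1)\<^sup>2\<close> (\<open>phi0_one\<close>,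
  \<open>convexity_poly_pos\<close>), hence also slightly beyond. In the formula for \<open>G''\<close>, replace the
  argument \<open>s = u\<^sup>2\<close> of \<open>F\<close> and \<open>Q\<close> by \<open>\<tau>(s)\<close>, where \<open>\<tau>\<close> is a smooth function that is the
  identity up to a point past \<open>s\<^sub>0\<close> and stays where \<open>F\<close> and \<open>Q\<close> are positive. This gives a
  smooth odd function, positive on the half line, and its second primitive with
  \<open>g(0) = 0\<close>, \<open>g'(0) = 1\<close> is the required \<open>g\<close> (\<open>convex_extension\<close>).
\<close>

section \<open>Curvature of rotationally symmetric metrics\<close>

lemma partial_deriv_eq:
  assumes "(f has_derivative f') (at x)"
  shows "partial_deriv i f x = f' (axis i 1)"
proof -
  have "((\<lambda>t. x + t *\<^sub>R axis i 1) has_derivative (\<lambda>t. t *\<^sub>R axis i 1)) (at 0)"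
    by (auto intro!: derivative_eq_intros)
  from has_derivative_compose[OF this, of f f'] assms
  have "((\<lambda>t. f (x + t *\<^sub>R axis i 1)) has_derivative (\<lambda>t. f' (t *\<^sub>R axis i 1))) (at 0)"
    by simp
  moreover have "linear f'" using assms by (rule has_derivative_linear)
  ultimately have "((\<lambda>t. f (x + t *\<^sub>R axis i 1)) has_real_derivative f' (axis i 1)) (at 0)"
    unfolding has_field_derivative_def
    by (elim has_derivative_eq_rhs) (simp add: linear_scale fun_eq_iff)
  then show ?thesis unfolding partial_deriv_def by (rule DERIV_imp_deriv)
qed

lemma sum_axis_linear:
  fixes f :: "real ^ 'n::finite \<Rightarrow> real"
  assumes "linear f"
  shows "(\<Sum>i\<in>UNIV. f (axis i 1) * v $ i) = f v"
proof -
  have "f v = f (\<Sum>i\<in>UNIV. v $ i *\<^sub>R axis i 1)"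
    using basis_expansion[of v] by (simp add: scalar_mult_eq_scaleR)
  also have "\<dots> = (\<Sum>i\<in>UNIV. f (axis i 1) * v $ i)"
    using assms by (simp add: linear_sum linear_scale mult.commute)
  finally show ?thesis by simp
qed

text \<open>
  A rotationally symmetric metric \<open>A(\<parallel>x\<parallel>\<^sup>2) (v \<bullet> w) + B(\<parallel>x\<parallel>\<^sup>2) (x \<bullet> v) (x \<bullet> w)\<close> on
  \<open>\<real>\<^sup>n\<close> for which radial lines have unit speed, so that \<open>A(s) = 1 - s B(s)\<close>. The functions
  \<open>B1\<close> and \<open>B2\<close> are the first two derivatives of \<open>B\<close>. Derivatives are two-sided also at \<open>0\<close>,
  so \<open>B\<close> must be chosen suitably on a negative neighbourhood of \<open>0\<close> as well.
\<close>

locale radial_metric =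
  fixes B B1 B2 :: "real \<Rightarrow> real"
  assumes B_deriv: "s \<ge> 0 \<Longrightarrow> (B has_real_derivative B1 s) (at s)"
    and B1_deriv: "s \<ge> 0 \<Longrightarrow> (B1 has_real_derivative B2 s) (at s)"
    and A_pos': "s \<ge> 0 \<Longrightarrow> 1 - s * B s > 0"
begin

text \<open>
  A suffix \<open>1\<close> or \<open>2\<close> marks a first or second derivative. The functions \<open>P\<close>, \<open>R\<close>, \<open>T\<close> are the
  coefficients of the connection (see \<open>conn\<close> below).
\<close>

definition "A s = 1 - s * B s"
definition "A1 s = - B s - s * B1 s"
definition "A2 s = - 2 * B1 s - s * B2 s"
definition "P s = A1 s / A s"
definition "P1 s = A2 s / A s - (A1 s / A s)\<^sup>2"
definition "R s = B s - A1 s"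
definition "R1 s = B1 s - A2 s"
definition "T s = B1 s - 2 * P s * B s"
definition "T1 s = B2 s - 2 * P1 s * B s - 2 * P s * B1 s"

definition metric :: "'n::finite metric_field" where
  "metric x v w = A (x \<bullet> x) * (v \<bullet> w) + B (x \<bullet> x) * (x \<bullet> v) * (x \<bullet> w)"

text \<open>
  The Christoffel symbols as a bilinear map: \<open>conn x v w\<close> is the covariant derivative at \<open>x\<close>, in
  direction \<open>v\<close>, of the constant vector field \<open>w\<close>.
\<close>

definition conn :: "real ^ 'n::finite \<Rightarrow> real ^ 'n \<Rightarrow> real ^ 'n \<Rightarrow> real ^ 'n" where
  "conn x v w = P (x \<bullet> x) *\<^sub>R ((x \<bullet> v) *\<^sub>R w + (x \<bullet> w) *\<^sub>R v)
     + (R (x \<bullet> x) * (v \<bullet> w) + T (x \<bullet> x) * (x \<bullet> v) * (x \<bullet> w)) *\<^sub>R x"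

text \<open>
  The derivative of \<open>y \<mapsto> conn y v w\<close> at \<open>x\<close> in direction \<open>u\<close>.
\<close>

definition conn' :: "real ^ 'n::finite \<Rightarrow> real ^ 'n \<Rightarrow> real ^ 'n \<Rightarrow> real ^ 'n \<Rightarrow> real ^ 'n" where
  "conn' x u v w = (2 * P1 (x \<bullet> x) * (x \<bullet> u)) *\<^sub>R ((x \<bullet> v) *\<^sub>R w + (x \<bullet> w) *\<^sub>R v)
     + P (x \<bullet> x) *\<^sub>R ((u \<bullet> v) *\<^sub>R w + (u \<bullet> w) *\<^sub>R v)
     + (2 * R1 (x \<bullet> x) * (x \<bullet> u) * (v \<bullet> w) + 2 * T1 (x \<bullet> x) * (x \<bullet> u) * (x \<bullet> v) * (x \<bullet> w)
        + T (x \<bullet> x) * ((u \<bullet> v) * (x \<bullet> w) + (x \<bullet> v) * (u \<bullet> w))) *\<^sub>R x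
     + (R (x \<bullet> x) * (v \<bullet> w) + T (x \<bullet> x) * (x \<bullet> v) * (x \<bullet> w)) *\<^sub>R u"

lemma A_pos: "s \<ge> 0 \<Longrightarrow> A s > 0"
  using A_pos' by (simp add: A_def)

lemma A_deriv: "s \<ge> 0 \<Longrightarrow> (A has_real_derivative A1 s) (at s)"
  unfolding A_def A1_def by (auto intro!: derivative_eq_intros B_deriv)

lemma A1_deriv: "s \<ge> 0 \<Longrightarrow> (A1 has_real_derivative A2 s) (at s)"
  unfolding A1_def A2_def by (auto intro!: derivative_eq_intros B_deriv B1_deriv)

lemma P_deriv: "s \<ge> 0 \<Longrightarrow> (P has_real_derivative P1 s) (at s)"
  unfolding P_def P1_def using A_pos[of s]
  by (auto intro!: derivative_eq_intros A_deriv A1_deriv simp: field_simps power2_eq_square)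

lemma R_deriv: "s \<ge> 0 \<Longrightarrow> (R has_real_derivative R1 s) (at s)"
  unfolding R_def R1_def by (auto intro!: derivative_eq_intros B_deriv A1_deriv)

lemma T_deriv: "s \<ge> 0 \<Longrightarrow> (T has_real_derivative T1 s) (at s)"
  unfolding T_def T1_def by (auto intro!: derivative_eq_intros B_deriv B1_deriv P_deriv)

lemma radial_deriv:
  assumes "\<And>s. s \<ge> 0 \<Longrightarrow> (f has_real_derivative f1 s) (at s)"
  shows "((\<lambda>y::real ^ 'n::finite. f (y \<bullet> y)) has_derivative (\<lambda>u. 2 * f1 (x \<bullet> x) * (x \<bullet> u))) (at x)"
proof -
  have "((\<lambda>y::real^'n. y \<bullet> y) has_derivative (\<lambda>u. 2 * (x \<bullet> u))) (at x)"
    by (auto intro!: derivative_eq_intros simp: inner_commute)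
  moreover have "(f has_derivative (\<lambda>t. f1 (x \<bullet> x) * t)) (at (x \<bullet> x))"
    using assms[of "x \<bullet> x"] by (simp add: has_field_derivative_def)
  ultimately have "((\<lambda>y::real^'n. f (y \<bullet> y)) has_derivative (\<lambda>u. f1 (x \<bullet> x) * (2 * (x \<bullet> u)))) (at x)"
    by (rule has_derivative_compose)
  then show ?thesis by (simp only: mult_ac)
qed

lemmas radial_derivs = radial_deriv[of A, OF A_deriv, simplified]
  radial_deriv[of B, OF B_deriv, simplified] radial_deriv[of P, OF P_deriv, simplified]
  radial_deriv[of R, OF R_deriv, simplified] radial_deriv[of T, OF T_deriv, simplified]

lemma conn_deriv: "((\<lambda>y. conn y v w) has_derivative (\<lambda>u. conn' x u v w)) (at x)"
  unfolding conn_def conn'_def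
  by (rule has_derivative_eq_rhs, (rule has_derivative_const has_derivative_ident
      has_derivative_add has_derivative_scaleR
      has_derivative_mult has_derivative_inner_left radial_derivs)+)
    (simp add: algebra_simps inner_commute fun_eq_iff)

lemma metric_deriv: "((\<lambda>y. metric y v w) has_derivative
    (\<lambda>u. 2 * A1 (x \<bullet> x) * (x \<bullet> u) * (v \<bullet> w) + 2 * B1 (x \<bullet> x) * (x \<bullet> u) * (x \<bullet> v) * (x \<bullet> w)
      + B (x \<bullet> x) * ((u \<bullet> v) * (x \<bullet> w) + (x \<bullet> v) * (u \<bullet> w)))) (at x)"
  unfolding metric_def
  by (rule has_derivative_eq_rhs, (rule has_derivative_const has_derivative_ident
      has_derivative_add has_derivative_scaleR
      has_derivative_mult has_derivative_inner_left radial_derivs)+)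
    (simp add: algebra_simps inner_commute fun_eq_iff)

text \<open>
  The \<open>k\<close>-th row of the inverse Gram matrix: the vector dual, with respect to the metric, to the
  \<open>k\<close>-th coordinate functional.
\<close>

definition raise :: "real ^ 'n::finite \<Rightarrow> 'n \<Rightarrow> real ^ 'n" where
  "raise x k = (1 / A (x \<bullet> x)) *\<^sub>R (axis k 1 - (B (x \<bullet> x) * (x $ k)) *\<^sub>R x)"

lemma metric_raise: "metric x v (raise x k) = v $ k"
proof -
  have "A (x \<bullet> x) \<noteq> 0" "A (x \<bullet> x) = 1 - (x \<bullet> x) * B (x \<bullet> x)"
    using A_pos[of "x \<bullet> x"] by (auto simp: A_def)
  then show ?thesis
    unfolding metric_def raise_def
    by (simp add: inner_diff_right inner_axis' inner_axis inner_commute[of v x] field_simps) algebra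
qed

lemma metric_linear: "linear (metric x v)"
  by (auto intro!: linearI simp: metric_def algebra_simps inner_add_right)

lemma gram_inv: "matrix_inv (gram metric (x :: real ^ 'n::finite)) = (\<chi> k l. raise x k $ l)"
proof -
  let ?M = "(\<chi> k l. raise x k $ l) :: real ^ 'n ^ 'n"
  have sym: "raise x k $ l = raise x l $ k" for k l
    by (auto simp: raise_def axis_def)
  have *: "(\<Sum>m\<in>UNIV. metric x (axis k 1) (axis m 1) * raise x l $ m) = mat 1 $ k $ l" for k l
    by (simp add: sum_axis_linear[OF metric_linear] metric_raise) (simp add: axis_def mat_def)
  have 1: "gram metric x ** ?M = mat 1"
    unfolding matrix_matrix_mult_def vec_eq_iff gram_def using * sym by simp
  have 2: "?M ** gram metric x = mat 1"
    using 1 by (simp add: matrix_left_right_inverse)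
  have "gram metric x ** matrix_inv (gram metric x) = mat 1"
    unfolding matrix_inv_def by (rule someI2[of _ ?M]) (use 1 2 in auto)
  then have "?M = ?M ** (gram metric x ** matrix_inv (gram metric x))" by simp
  also have "\<dots> = matrix_inv (gram metric x)"
    by (simp only: matrix_mul_assoc 2 matrix_mul_lid)
  finally show ?thesis by simp
qed

lemma christoffel_metric: "christoffel metric k i j (x :: real ^ 'n::finite) = conn x (axis i 1) (axis j 1) $ k"
proof -
  define s where "s = x \<bullet> x"
  define D where "D u v w = 2 * A1 s * (x \<bullet> u) * (v \<bullet> w) + 2 * B1 s * (x \<bullet> u) * (x \<bullet> v) * (x \<bullet> w)
      + B s * ((u \<bullet> v) * (x \<bullet> w) + (x \<bullet> v) * (u \<bullet> w))" for u v w :: "real ^ 'n"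
  let ?e = "\<lambda>i. axis i 1 :: real ^ 'n"
  have pd: "partial_deriv i (\<lambda>y. gram metric y $ j $ l) x = D (?e i) (?e j) (?e l)" for i j l
    using partial_deriv_eq[OF metric_deriv] by (simp add: gram_def D_def s_def)
  define f where "f u = D (?e i) (?e j) u + D (?e j) (?e i) u - D u (?e i) (?e j)" for u
  have lin: "linear f"
    by (auto intro!: linearI simp: f_def D_def algebra_simps inner_add_right inner_add_left)
  have "christoffel metric k i j x = (1/2) * (\<Sum>l\<in>UNIV. f (?e l) * raise x k $ l)"
    unfolding christoffel_def gram_inv pd by (simp add: f_def mult.commute)
  also have "\<dots> = f (raise x k) / 2"
    by (simp add: sum_axis_linear[OF lin])
  also have "\<dots> = conn x (?e i) (?e j) $ k"
  proof -
    have A: "A s \<noteq> 0" "A s = 1 - s * B s" using A_pos[of s] by (auto simp: A_def s_def)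
    have x: "x \<bullet> raise x k = x $ k"
      using A(1) by (simp add: raise_def inner_diff_right inner_axis s_def[symmetric] field_simps)
        (simp add: A(2) algebra_simps)
    have e: "raise x k \<bullet> axis i 1 = (axis i 1 $ k - B s * (x $ k) * (x $ i)) / A s"
       "axis i 1 \<bullet> raise x k = (axis i 1 $ k - B s * (x $ k) * (x $ i)) / A s" for i
      using A(1) by (auto simp: raise_def inner_axis inner_axis' inner_diff_right inner_diff_left
          inner_commute[of "axis _ _" x] s_def[symmetric] field_simps) (auto simp: axis_def)
    have ax: "axis j 1 $ i = (axis i 1 $ j :: real)"
      by (simp add: axis_def)
    have "f (raise x k) = 2 * (conn x (?e i) (?e j) $ k)"
      unfolding f_def D_def x e conn_def s_def[symmetric] P_def T_def R_def using A(1)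
      by (simp add: inner_axis ax field_simps)
    then show ?thesis by simp
  qed
  finally show ?thesis .
qed

lemma riemann_metric:
  "riemann metric (x :: real ^ 'n::finite) v w z = conn' x v w z - conn' x w v z
     + (conn x v (conn x w z) - conn x w (conn x v z))"
  (is "_ = ?R v w z")
proof -
  let ?e = "\<lambda>i. axis i 1 :: real ^ 'n"
  have ch: "christoffel metric k i j = (\<lambda>y. conn y (?e i) (?e j) $ k)" for k i j
    by (rule ext) (rule christoffel_metric)
  have pd: "partial_deriv i (\<lambda>y. conn y (?e j) (?e k) $ l) x = conn' x (?e i) (?e j) (?e k) $ l" for i j k l
    by (rule partial_deriv_eq[of _ "\<lambda>u. conn' x u (?e j) (?e k) $ l"])
       (intro bounded_linear.has_derivative[OF bounded_linear_vec_nth] conn_deriv)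
  have lin: "linear (\<lambda>u. conn x v u $ l)" for v l
    by (auto intro!: linearI simp: conn_def algebra_simps inner_add_right)
  have rc: "riemann_coeff metric l i j k x = ?R (?e i) (?e j) (?e k) $ l" for l i j k
    unfolding riemann_coeff_def ch pd
    by (simp add: sum_subtractf sum_axis_linear[OF lin])
  have lin1: "linear (\<lambda>v. ?R v w z $ l)" for w z l
    by (auto intro!: linearI simp: conn_def conn'_def algebra_simps inner_add_right inner_add_left)
  have lin2: "linear (\<lambda>w. ?R v w z $ l)" for v z l
    by (auto intro!: linearI simp: conn_def conn'_def algebra_simps inner_add_right inner_add_left)
  have lin3: "linear (\<lambda>z. ?R v w z $ l)" for w v l
    by (auto intro!: linearI simp: conn_def conn'_def algebra_simps inner_add_right inner_add_left)
  have "riemann metric x v w z $ l = ?R v w z $ l" for l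
  proof -
    have "riemann metric x v w z $ l = (\<Sum>i\<in>UNIV. \<Sum>j\<in>UNIV. \<Sum>k\<in>UNIV.
        ?R (?e i) (?e j) (?e k) $ l * (v $ i) * (w $ j) * (z $ k))"
      unfolding riemann_def rc by simp
    also have "\<dots> = (\<Sum>i\<in>UNIV. (\<Sum>j\<in>UNIV. (\<Sum>k\<in>UNIV.
        ?R (?e i) (?e j) (?e k) $ l * (z $ k)) * (w $ j)) * (v $ i))"
      unfolding sum_distrib_right by (simp only: mult_ac)
    also have "\<dots> = ?R v w z $ l"
      by (simp only: sum_axis_linear[OF lin3] sum_axis_linear[OF lin2] sum_axis_linear[OF lin1])
    finally show ?thesis .
  qed
  then show ?thesis by (simp add: vec_eq_iff)
qed

text \<open>
  Coefficients of the curvature form in \<open>metric_riemann\<close>. In terms of the profile,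
  \<open>curv_tan\<close> is \<open>A\<^sup>2\<close> times the tangential curvature, and \<open>curv_tan + s curv_mix\<close> is \<open>A\<close> times
  the radial curvature.
\<close>

definition curv_tan :: "real \<Rightarrow> real" where
  "curv_tan s = A s * B s - 2 * A s * A1 s - s * (A1 s)\<^sup>2"

definition curv_mix :: "real \<Rightarrow> real" where
  "curv_mix s = B1 s + 3 * (B s)\<^sup>2 + 2 * s * B s * B1 s - 2 * A2 s + (A1 s)\<^sup>2 / A s + (A1 s)\<^sup>2"

lemma curv_mix_eq: "s \<ge> 0 \<Longrightarrow> curv_tan s + s * curv_mix s = - 3 * A1 s - 2 * s * A2 s + s * (A1 s)\<^sup>2 / A s"
  using A_pos[of s] unfolding curv_tan_def curv_mix_def
  by (simp add: A1_def A2_def field_simps power2_eq_square) (simp add: A_def algebra_simps)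

text \<open>
  The factor of \<open>curv_tan\<close> is the Euclidean Gram determinant of \<open>v, w\<close>; that of \<open>curv_mix\<close> is the
  squared length of \<open>(x \<bullet> v) w - (x \<bullet> w) v\<close>, which vanishes when \<open>v, w\<close> are tangential.
\<close>

lemma metric_riemann:
  fixes x v w :: "real ^ 'n::finite"
  shows "metric x (riemann metric x v w w) v =
    curv_tan (x \<bullet> x) * ((v \<bullet> v) * (w \<bullet> w) - (v \<bullet> w)\<^sup>2) +
    curv_mix (x \<bullet> x) * ((x \<bullet> v)\<^sup>2 * (w \<bullet> w) - 2 * (x \<bullet> v) * (x \<bullet> w) * (v \<bullet> w) + (x \<bullet> w)\<^sup>2 * (v \<bullet> v))"
proof -
  define s where "s = x \<bullet> x"
  have A: "A s \<noteq> 0" using A_pos[of s] by (auto simp: s_def)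
  \<comment> \<open>Once \<open>A\<close>, \<open>A1\<close>, \<open>A2\<close> are expressed by \<open>s\<close>, \<open>B\<close>, \<open>B1\<close>, \<open>B2\<close> and the denominators
      \<open>A\<close> are cleared, this is a polynomial identity in those and the inner products of \<open>x, v, w\<close>.\<close>
  show ?thesis
    unfolding riemann_metric metric_def conn_def conn'_def s_def[symmetric]
    unfolding inner_add_left inner_diff_left inner_scaleR_left inner_add_right inner_diff_right
      inner_scaleR_right s_def[symmetric] inner_commute[of v x] inner_commute[of w x]
      inner_commute[of w v]
    unfolding curv_tan_def curv_mix_def R_def R1_def T_def T1_def P_def P1_def
    using A by (simp add: divide_simps) (simp only: A1_def A2_def, simp add: A_def, algebra)
qed

end

section \<open>Negative curvature of warped products\<close>

lemma gram_det_pos: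
  fixes v w :: "'a::real_inner"
  assumes "independent {v, w}" "v \<noteq> w"
  shows "(v \<bullet> v) * (w \<bullet> w) - (v \<bullet> w)\<^sup>2 > 0"
proof -
  have "w \<noteq> 0" using assms(1) dependent_zero by blast
  have "(v \<bullet> w)\<^sup>2 \<noteq> (v \<bullet> v) * (w \<bullet> w)"
  proof
    assume eq: "(v \<bullet> w)\<^sup>2 = (v \<bullet> v) * (w \<bullet> w)"
    define z where "z = v - ((v \<bullet> w) / (w \<bullet> w)) *\<^sub>R w"
    have "z \<bullet> z = 0"
      using eq \<open>w \<noteq> 0\<close> by (simp add: z_def inner_diff_left inner_diff_right inner_commute field_simps power2_eq_square)
    then have "v = ((v \<bullet> w) / (w \<bullet> w)) *\<^sub>R w" by (simp add: z_def)
    then have "v \<in> span {w}" by (metis span_mul span_base singletonI)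
    then show False
      using assms by (simp add: independent_insert)
  qed
  moreover have "(v \<bullet> w)\<^sup>2 \<le> (v \<bullet> v) * (w \<bullet> w)" by (rule Cauchy_Schwarz_ineq)
  ultimately show ?thesis by simp
qed

context radial_metric
begin

lemma negative_curvature:
  assumes tan: "\<And>s. s \<ge> 0 \<Longrightarrow> curv_tan s < 0"
    and rad: "\<And>s. s > 0 \<Longrightarrow> - 3 * A1 s - 2 * s * A2 s + s * (A1 s)\<^sup>2 / A s < 0"
  shows "negative_sectional_curvature (metric :: 'n::finite metric_field)"
  unfolding negative_sectional_curvature_def
proof (intro allI impI, elim conjE)
  fix x v w :: "real ^ 'n"
  assume vw: "v \<noteq> w" "independent {v, w}"
  define s N M where "s = x \<bullet> x" and "N = (v \<bullet> v) * (w \<bullet> w) - (v \<bullet> w)\<^sup>2"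
    and "M = (x \<bullet> v)\<^sup>2 * (w \<bullet> w) - 2 * (x \<bullet> v) * (x \<bullet> w) * (v \<bullet> w) + (x \<bullet> w)\<^sup>2 * (v \<bullet> v)"
  have N: "N > 0" unfolding N_def using vw by (intro gram_det_pos)
  have "M = ((x \<bullet> v) *\<^sub>R w - (x \<bullet> w) *\<^sub>R v) \<bullet> ((x \<bullet> v) *\<^sub>R w - (x \<bullet> w) *\<^sub>R v)"
    by (simp add: M_def inner_diff_left inner_diff_right inner_commute[of w v] power2_eq_square algebra_simps)
  then have M: "M \<ge> 0" by simp
  have A: "A s > 0" by (rule A_pos) (simp add: s_def)
  have num: "metric x (riemann metric x v w w) v = curv_tan s * N + curv_mix s * M"
    by (simp add: metric_riemann s_def N_def M_def)
  have den: "metric x v v * metric x w w - (metric x v w)\<^sup>2 = A s * (A s * N + B s * M)"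
    by (simp add: metric_def s_def[symmetric] N_def M_def power2_eq_square algebra_simps)
  have "curv_tan s * N + curv_mix s * M < 0 \<and> A s * N + B s * M > 0"
  proof (cases "s = 0")
    case True
    then have "M = 0" by (simp add: s_def M_def)
    then show ?thesis using tan[of s] N A True by (simp add: mult_neg_pos)
  next
    case False
    then have s: "s > 0" by (simp add: s_def)
    \<comment> \<open>Splitting off the components along \<open>x\<close> writes numerator and denominator as combinations of
        the same two nonnegative quantities \<open>N - M / s\<close> and \<open>M / s\<close>, which are not both \<open>0\<close>.\<close>
    define v' w' where "v' = v - ((x \<bullet> v) / s) *\<^sub>R x" and "w' = w - ((x \<bullet> w) / s) *\<^sub>R x"
    have "(v' \<bullet> v') * (w' \<bullet> w') - (v' \<bullet> w')\<^sup>2 = N - M / s"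
      using s by (simp add: v'_def w'_def N_def M_def inner_diff_left inner_diff_right s_def[symmetric]
          inner_commute[of v x] inner_commute[of w x] field_simps) algebra
    then have M': "N - M / s \<ge> 0"
      using Cauchy_Schwarz_ineq[of v' w'] by simp
    have "curv_tan s * N + curv_mix s * M
        = curv_tan s * (N - M / s) + (curv_tan s + s * curv_mix s) * (M / s)"
      using s by (simp add: field_simps)
    moreover have "A s * N + B s * M = A s * (N - M / s) + M / s"
      using s by (simp add: A_def field_simps)
    moreover have "N - M / s > 0 \<or> M / s > 0" using N M' by linarith
    moreover have "M / s \<ge> 0" using M s by simp
    moreover have "curv_tan s < 0" "curv_tan s + s * curv_mix s < 0"
      using tan[of s] rad[of s] s by (simp_all add: curv_mix_eq)
    ultimately show ?thesis using A M'
      by (smt (verit) mult_neg_pos mult_nonneg_nonneg mult_nonpos_nonneg mult_pos_pos)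
  qed
  then show "sectional_curvature metric x v w < 0"
    unfolding sectional_curvature_def num den using A by (simp add: divide_neg_pos)
qed

end

text \<open>
  The hypothesis \<open>germ\<close> says that \<open>B(u\<^sup>2) = (1 - g(u)\<^sup>2 / u\<^sup>2) / u\<^sup>2\<close> is \<open>\<beta> + \<gamma> u\<^sup>2\<close> near \<open>0\<close>,
  so that \<open>B\<close> extends smoothly across \<open>0\<close> and the metric is smooth at the pole.
\<close>

lemma warped_metric_negative:
  fixes g g1 g2 :: "real \<Rightarrow> real"
  assumes g1: "\<And>u. u > 0 \<Longrightarrow> (g has_real_derivative g1 u) (at u)"
    and g2: "\<And>u. u > 0 \<Longrightarrow> (g1 has_real_derivative g2 u) (at u)"
    and pos: "\<And>u. u > 0 \<Longrightarrow> g u > 0" "\<And>u. u > 0 \<Longrightarrow> g1 u > 1" "\<And>u. u > 0 \<Longrightarrow> g2 u > 0"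
    and r: "r > 0"
    and germ: "\<And>u. 0 < u \<Longrightarrow> u < r \<Longrightarrow> (g u)\<^sup>2 = u\<^sup>2 * (1 - u\<^sup>2 * (\<beta> + \<gamma> * u\<^sup>2))"
    and \<beta>: "\<beta> < 0"
  shows "negative_sectional_curvature (warped_metric g :: 'n::finite metric_field)"
proof -
  \<comment> \<open>\<open>C\<close> is \<open>B\<close> on the half line, in terms of \<open>g\<close>; \<open>C1\<close> and \<open>C2\<close> are its derivatives.\<close>
  define C where "C s = 1 / s - (g (sqrt s))\<^sup>2 / s\<^sup>2" for s
  define C1 where "C1 s = - 1 / s\<^sup>2 - g (sqrt s) * g1 (sqrt s) / sqrt s ^ 5 + 2 * (g (sqrt s))\<^sup>2 / s ^ 3" for s
  define C2 where "C2 s = 2 / s ^ 3 - ((g1 (sqrt s))\<^sup>2 + g (sqrt s) * g2 (sqrt s)) / (2 * s ^ 3)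
    + 9 * g (sqrt s) * g1 (sqrt s) / (2 * sqrt s ^ 7) - 6 * (g (sqrt s))\<^sup>2 / s ^ 4" for s
  have gs: "((\<lambda>s. g (sqrt s)) has_real_derivative g1 (sqrt s) / (2 * sqrt s)) (at s)"
    and g1s: "((\<lambda>s. g1 (sqrt s)) has_real_derivative g2 (sqrt s) / (2 * sqrt s)) (at s)" if "s > 0" for s
    using DERIV_chain2[OF g1 DERIV_real_sqrt, of s] DERIV_chain2[OF g2 DERIV_real_sqrt, of s] that
    by (simp_all add: field_simps)
  have C1: "(C has_real_derivative C1 s) (at s)" if "s > 0" for s
  proof -
    define u where "u = sqrt s"
    have u: "u > 0" "s = u\<^sup>2" "sqrt s = u" "sqrt (u\<^sup>2) = u" using that by (auto simp: u_def)
    show ?thesis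
      unfolding C_def C1_def using u(1) that
      by (auto intro!: derivative_eq_intros gs) (simp add: u(3) u(2) u(4) field_simps power2_eq_square, algebra)
  qed
  have C2: "(C1 has_real_derivative C2 s) (at s)" if "s > 0" for s
  proof -
    define u where "u = sqrt s"
    have u: "u > 0" "s = u\<^sup>2" "sqrt s = u" "sqrt (u\<^sup>2) = u" using that by (auto simp: u_def)
    show ?thesis
      unfolding C1_def C2_def using u(1) that
      by (auto intro!: derivative_eq_intros gs g1s) (simp add: u(3) u(2) u(4) field_simps power2_eq_square, algebra)
  qed
  define s1 where "s1 = r\<^sup>2"
  have s1: "s1 > 0" using r by (simp add: s1_def)
  have Cs: "C s = \<beta> + \<gamma> * s" if "0 < s" "s < s1" for s
  proof -
    have "sqrt s < r" using that r by (simp add: s1_def real_less_lsqrt)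
    then show ?thesis using germ[of "sqrt s"] that by (simp add: C_def field_simps power2_eq_square)
  qed
  have C1s: "C1 s = \<gamma>" if "0 < s" "s < s1" for s
  proof -
    have "((\<lambda>s. \<beta> + \<gamma> * s) has_real_derivative \<gamma>) (at s)" by (auto intro!: derivative_eq_intros)
    then have "(C has_real_derivative \<gamma>) (at s)"
      by (rule has_field_derivative_transform_within_open[of _ _ _ "{0<..<s1}"])
         (use that Cs in auto)
    with C1[OF that(1)] show ?thesis by (rule DERIV_unique)
  qed
  have C2s: "C2 s = 0" if "0 < s" "s < s1" for s
  proof -
    have "((\<lambda>s. \<gamma>) has_real_derivative 0) (at s)" by (auto intro!: derivative_eq_intros)
    then have "(C1 has_real_derivative 0) (at s)"
      by (rule has_field_derivative_transform_within_open[of _ _ _ "{0<..<s1}"])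
         (use that C1s in auto)
    with C2[OF that(1)] show ?thesis by (rule DERIV_unique)
  qed
  \<comment> \<open>Since \<open>C\<close> is affine on \<open>(0, s1)\<close>, continuing it by the same affine function is smooth at \<open>0\<close>.\<close>
  define B where "B s = (if s \<le> 0 then \<beta> + \<gamma> * s else C s)" for s
  define B1 where "B1 s = (if s \<le> 0 then \<gamma> else C1 s)" for s
  define B2 where "B2 s = (if s \<le> 0 then 0 else C2 s)" for s
  have D: "(f has_real_derivative f1 s) (at s)"
    if f: "f = (\<lambda>s. if s \<le> 0 then p + q * s else h s)" "f1 = (\<lambda>s. if s \<le> 0 then q else h1 s)"
    and h: "\<And>s. s > 0 \<Longrightarrow> (h has_real_derivative h1 s) (at s)" "\<And>s. 0 < s \<Longrightarrow> s < s1 \<Longrightarrow> h s = p + q * s"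
    for f f1 h h1 :: "real \<Rightarrow> real" and p q s
  proof (cases "s \<le> 0")
    case True
    have "((\<lambda>s. p + q * s) has_real_derivative q) (at s)" by (auto intro!: derivative_eq_intros)
    then have "(f has_real_derivative q) (at s)"
      by (rule has_field_derivative_transform_within_open[of _ _ _ "{..<s1}"]) (use True s1 f(1) h in auto)
    then show ?thesis using True f by simp
  next
    case False
    then have "(f has_real_derivative h1 s) (at s)"
      by (intro has_field_derivative_transform_within_open[OF h(1), of s "{0<..}"]) (use False f in auto)
    then show ?thesis using False f by simp
  qed
  have BB: "(B has_real_derivative B1 s) (at s)" for s
    by (rule D[of B \<beta> \<gamma> C B1 C1]) (auto simp: B_def B1_def C1 Cs)
  have BB1: "(B1 has_real_derivative B2 s) (at s)" for s
    by (rule D[of B1 \<gamma> 0 C1 B2 C2]) (auto simp: B1_def B2_def C2 C1s)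
  have sB: "1 - s * B s = (g (sqrt s))\<^sup>2 / s" if "s > 0" for s
    using that by (simp add: B_def C_def field_simps power2_eq_square)
  have BC: "B s = 1 / s - (g (sqrt s))\<^sup>2 / s\<^sup>2" if "s > 0" for s
    using that by (simp add: B_def C_def)
  interpret radial_metric B B1 B2
  proof
    fix s :: real assume "s \<ge> 0"
    show "1 - s * B s > 0"
    proof (cases "s = 0")
      case False
      then have "s > 0" using \<open>s \<ge> 0\<close> by simp
      with sB pos(1)[of "sqrt s"] show ?thesis by simp
    qed simp
  qed (use BB BB1 in auto)
  have "warped_metric g x v w = metric x v w" for x v w :: "real ^ 'n"
  proof (cases "x = 0")
    case False
    then have s: "x \<bullet> x > 0" by simp
    have n: "norm x = sqrt (x \<bullet> x)" by (simp add: norm_eq_sqrt_inner)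
    have B: "B (x \<bullet> x) = 1 / (x \<bullet> x) - (g (norm x))\<^sup>2 / (x \<bullet> x)\<^sup>2"
      using BC[OF s] by (simp add: n)
    have A: "A (x \<bullet> x) = (g (norm x))\<^sup>2 / (x \<bullet> x)"
      using sB[OF s] by (simp add: A_def n)
    have "x \<bullet> x = (norm x)\<^sup>2" by (simp add: dot_square_norm)
    then show ?thesis
      using False unfolding warped_metric_def metric_def A B d_radius_def d_angle_def
      by (simp add: inner_diff_left inner_diff_right inner_commute[of v x] power2_eq_square field_simps)
  qed (simp add: warped_metric_def metric_def A_def)
  then have eq: "(warped_metric g :: 'n metric_field) = metric" by (simp add: fun_eq_iff)
  have AA: "A s = (g (sqrt s))\<^sup>2 / s"
    "A1 s = g (sqrt s) * g1 (sqrt s) / sqrt s ^ 3 - (g (sqrt s))\<^sup>2 / s\<^sup>2"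
    "A2 s = ((g1 (sqrt s))\<^sup>2 + g (sqrt s) * g2 (sqrt s)) / (2 * s\<^sup>2)
      - 5 * g (sqrt s) * g1 (sqrt s) / (2 * sqrt s ^ 5) + 2 * (g (sqrt s))\<^sup>2 / s ^ 3"
    if "s > 0" for s
  proof -
    define u where "u = sqrt s"
    have u: "u > 0" "s = u\<^sup>2" "sqrt (u\<^sup>2) = u" using that by (auto simp: u_def)
    show "A s = (g (sqrt s))\<^sup>2 / s" using sB[OF that] by (simp add: A_def)
    show "A1 s = g (sqrt s) * g1 (sqrt s) / sqrt s ^ 3 - (g (sqrt s))\<^sup>2 / s\<^sup>2"
      using that u(1) unfolding A1_def B_def B1_def C_def C1_def u(2,3)
      by (simp add: field_simps) algebra
    show "A2 s = ((g1 (sqrt s))\<^sup>2 + g (sqrt s) * g2 (sqrt s)) / (2 * s\<^sup>2)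
      - 5 * g (sqrt s) * g1 (sqrt s) / (2 * sqrt s ^ 5) + 2 * (g (sqrt s))\<^sup>2 / s ^ 3"
      using that u(1) unfolding A2_def B1_def B2_def C1_def C2_def u(2,3)
      by (simp add: field_simps)
  qed
  show ?thesis unfolding eq
  proof (rule negative_curvature)
    fix s :: real assume s: "s > 0"
    define u where "u = sqrt s"
    have u: "u > 0" "s = u\<^sup>2" "sqrt (u\<^sup>2) = u" using s by (auto simp: u_def)
    have "- 3 * A1 s - 2 * s * A2 s + s * (A1 s)\<^sup>2 / A s = - g u * g2 u / u\<^sup>2"
      using s u(1) pos(1)[OF u(1)] unfolding AA[OF s] unfolding u(2,3)
      by (simp add: field_simps) algebra
    also have "\<dots> < 0" using u(1) pos[OF u(1)] by (simp add: divide_neg_pos)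
    finally show "- 3 * A1 s - 2 * s * A2 s + s * (A1 s)\<^sup>2 / A s < 0" .
  next
    fix s :: real assume "s \<ge> 0"
    show "curv_tan s < 0"
    proof (cases "s = 0")
      case True
      then show ?thesis using \<beta> by (simp add: curv_tan_def A_def A1_def B_def)
    next
      case False
      then have s: "s > 0" using \<open>s \<ge> 0\<close> by simp
      define u where "u = sqrt s"
      have u: "u > 0" "s = u\<^sup>2" "sqrt (u\<^sup>2) = u" using s by (auto simp: u_def)
      have "curv_tan s = (g u)\<^sup>2 * (1 - (g1 u)\<^sup>2) / u ^ 4"
        using u(1) unfolding curv_tan_def AA[OF s] BC[OF s] unfolding u(2,3)
        by (simp add: field_simps) algebra
      also have "\<dots> < 0"
        using u(1) pos[OF u(1)] by (simp add: divide_neg_pos mult_pos_neg)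
      finally show ?thesis .
    qed
  qed
qed

section \<open>Smooth functions on the line\<close>

text \<open>
  \<open>times_diff n f\<close> says that \<open>f\<close> is \<open>n\<close> times differentiable on \<open>\<real>\<close>. The recursion on an
  explicit derivative, rather than on \<open>deriv\<close>, makes the closure properties direct inductions.
\<close>

primrec times_diff :: "nat \<Rightarrow> (real \<Rightarrow> real) \<Rightarrow> bool" where
  "times_diff 0 f \<longleftrightarrow> True"
| "times_diff (Suc n) f \<longleftrightarrow> (\<exists>f'. (\<forall>x. (f has_real_derivative f' x) (at x)) \<and> times_diff n f')"

lemma times_diff_SucI:
  "(\<And>x. (f has_real_derivative f' x) (at x)) \<Longrightarrow> times_diff n f' \<Longrightarrow> times_diff (Suc n) f"
  by auto

lemma times_diff_SucD: "times_diff (Suc n) f \<Longrightarrow> times_diff n f"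
  by (induction n arbitrary: f) auto

lemma C_infinityI:
  assumes "\<And>n. times_diff n f"
  shows "C_infinity f"
  unfolding C_infinity_def
proof (intro allI)
  fix k x
  have "times_diff (Suc k) f \<Longrightarrow> (deriv ^^ k) f differentiable (at x)" for f
  proof (induction k arbitrary: f)
    case 0
    then show ?case by (auto simp: real_differentiable_def)
  next
    case (Suc k)
    then obtain f' where f': "\<And>x. (f has_real_derivative f' x) (at x)" "times_diff (Suc k) f'"
      by auto
    then have "deriv f = f'" by (auto intro: DERIV_imp_deriv)
    then show ?case using Suc.IH[OF f'(2)] by (simp add: funpow_swap1)
  qed
  with assms show "(deriv ^^ k) f differentiable (at x)" by blast
qed

lemma times_diff_const: "times_diff n (\<lambda>x. c)"
  by (induction n arbitrary: c) (auto intro!: exI[of _ "\<lambda>x. 0"])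

lemma times_diff_id: "times_diff n (\<lambda>x. x)"
  by (cases n) (auto intro!: exI[of _ "\<lambda>x. 1"] times_diff_const)

lemma times_diff_add: "times_diff n f \<Longrightarrow> times_diff n g \<Longrightarrow> times_diff n (\<lambda>x. f x + g x)"
proof (induction n arbitrary: f g)
  case (Suc n)
  then obtain f' g' where "\<And>x. (f has_real_derivative f' x) (at x)" "times_diff n f'"
    "\<And>x. (g has_real_derivative g' x) (at x)" "times_diff n g'" by auto
  with Suc.IH show ?case
    by (intro times_diff_SucI[of _ "\<lambda>x. f' x + g' x"]) (auto intro: DERIV_add)
qed simp

lemma times_diff_mult: "times_diff n f \<Longrightarrow> times_diff n g \<Longrightarrow> times_diff n (\<lambda>x. f x * g x)"
proof (induction n arbitrary: f g)
  case (Suc n)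
  then obtain f' g' where "\<And>x. (f has_real_derivative f' x) (at x)" "times_diff n f'"
    "\<And>x. (g has_real_derivative g' x) (at x)" "times_diff n g'" by auto
  with Suc.IH Suc.prems[THEN times_diff_SucD] show ?case
    by (intro times_diff_SucI[of _ "\<lambda>x. f' x * g x + g' x * f x"])
       (auto intro!: DERIV_mult times_diff_add)
qed simp

lemma times_diff_diff:
  assumes "times_diff n f" "times_diff n g"
  shows "times_diff n (\<lambda>x. f x - g x)"
  using times_diff_add[OF assms(1) times_diff_mult[OF times_diff_const[of n "-1"] assms(2)]] by simp

lemma times_diff_power: "times_diff n f \<Longrightarrow> times_diff n (\<lambda>x. f x ^ k)"
  by (induction k) (auto intro: times_diff_const times_diff_mult)

lemma times_diff_inverse:
  "times_diff n f \<Longrightarrow> (\<And>x. f x \<noteq> 0) \<Longrightarrow> times_diff n (\<lambda>x. inverse (f x))"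
proof (induction n)
  case (Suc n)
  then obtain f' where f': "\<And>x. (f has_real_derivative f' x) (at x)" "times_diff n f'" by auto
  have "times_diff n (\<lambda>x. inverse (f x))" using Suc times_diff_SucD by blast
  then have "times_diff n (\<lambda>x. - 1 * (inverse (f x) * f' x * inverse (f x)))"
    by (intro times_diff_mult times_diff_const f')
  then show ?case
    by (rule times_diff_SucI[rotated])
       (use DERIV_inverse'[OF f'(1) Suc.prems(2)] in simp)
qed simp

lemma times_diff_divide:
  assumes "times_diff n f" "times_diff n g" "\<And>x. g x \<noteq> 0"
  shows "times_diff n (\<lambda>x. f x / g x)"
  using times_diff_mult[OF assms(1) times_diff_inverse[OF assms(2,3)]] by (simp add: divide_inverse)

lemma times_diff_sqrt:
  "times_diff n f \<Longrightarrow> (\<And>x. f x > 0) \<Longrightarrow> times_diff n (\<lambda>x. sqrt (f x))"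
proof (induction n)
  case (Suc n)
  then obtain f' where f': "\<And>x. (f has_real_derivative f' x) (at x)" "times_diff n f'" by auto
  have "times_diff n (\<lambda>x. sqrt (f x))" using Suc times_diff_SucD by blast
  then have *: "times_diff n (\<lambda>x. f' x / (2 * sqrt (f x)))"
    using less_imp_neq[OF Suc.prems(2)] by (intro times_diff_mult times_diff_divide times_diff_const f') auto
  show ?case
  proof (rule times_diff_SucI[OF _ *])
    show "((\<lambda>x. sqrt (f x)) has_real_derivative f' x / (2 * sqrt (f x))) (at x)" for x
      using DERIV_chain2[OF DERIV_real_sqrt[OF Suc.prems(2)] f'(1), of x] by (simp add: field_simps)
  qed
qed simp

lemma times_diff_compose:
  "times_diff n f \<Longrightarrow> times_diff n g \<Longrightarrow> times_diff n (\<lambda>x. f (g x))"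
proof (induction n arbitrary: f g)
  case (Suc n)
  then obtain f' g' where "\<And>x. (f has_real_derivative f' x) (at x)" "times_diff n f'"
    "\<And>x. (g has_real_derivative g' x) (at x)" "times_diff n g'" by auto
  with Suc.IH Suc.prems[THEN times_diff_SucD] show ?case
    by (intro times_diff_SucI[of _ "\<lambda>x. f' (g x) * g' x"])
       (auto intro!: DERIV_chain2[of f] times_diff_mult)
qed simp

text \<open>
  The functions \<open>exp(- 1 / t) / t\<^sup>k\<close>, extended by \<open>0\<close> to \<open>t \<le> 0\<close>. Their span is closed under
  differentiation, so they are smooth.
\<close>

definition flat :: "nat \<Rightarrow> real \<Rightarrow> real" where
  "flat k t = (if t \<le> 0 then 0 else exp (- 1 / t) / t ^ k)"

lemma flat_tendsto_0: "((\<lambda>t. flat k t) \<longlongrightarrow> 0) (at 0)"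
proof -
  have "((\<lambda>t::real. inverse t ^ k / exp (inverse t)) \<longlongrightarrow> 0) (at_right 0)"
    by (rule filterlim_compose[OF tendsto_power_div_exp_0 filterlim_inverse_at_top_right])
  then have "(flat k \<longlongrightarrow> 0) (at_right 0)"
    by (rule Lim_transform_eventually)
       (auto simp: eventually_at_filter flat_def exp_minus field_simps power_one_over divide_inverse[of "- 1"])
  moreover have "(flat k \<longlongrightarrow> 0) (at_left 0)"
    by (rule Lim_transform_eventually[OF tendsto_const]) (auto simp: eventually_at_filter flat_def)
  ultimately show ?thesis by (simp add: filterlim_split_at)
qed

lemma flat_deriv: "(flat k has_real_derivative (flat (k + 2) t - real k * flat (Suc k) t)) (at t)"
proof (cases t "0 :: real" rule: linorder_cases)
  case less
  have "((\<lambda>t. 0) has_real_derivative 0) (at t)" by simp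
  then have "(flat k has_real_derivative 0) (at t)"
    by (rule has_field_derivative_transform_within_open[of _ _ _ "{..<0}"]) (use less in \<open>auto simp: flat_def\<close>)
  then show ?thesis using less by (simp add: flat_def)
next
  case equal
  have "flat k h / h = flat (Suc k) h" if "h \<noteq> 0" for h
    using that by (auto simp: flat_def)
  then have "((\<lambda>h. flat k h / h) \<longlongrightarrow> 0) (at 0)"
    by (intro Lim_transform_eventually[OF flat_tendsto_0[of "Suc k"]]) (auto simp: eventually_at_filter)
  then show ?thesis using equal by (simp add: DERIV_def flat_def)
next
  case greater
  have pm: "t ^ m \<noteq> t * t ^ (m - Suc 0) \<Longrightarrow> m = 0" for m by (cases m) auto
  have "((\<lambda>t. exp (- 1 / t) / t ^ k) has_real_derivative (flat (k + 2) t - real k * flat (Suc k) t)) (at t)"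
    using greater
    by (cases k) (auto intro!: derivative_eq_intros simp: flat_def field_simps power2_eq_square intro: pm)
  then show ?thesis
    by (rule has_field_derivative_transform_within_open[of _ _ _ "{0<..}"]) (use greater in \<open>auto simp: flat_def\<close>)
qed

lemma times_diff_flat: "times_diff n (flat k)"
proof (induction n arbitrary: k)
  case (Suc n)
  then show ?case
    by (intro times_diff_SucI[OF flat_deriv] times_diff_diff times_diff_mult times_diff_const)
qed simp

text \<open>
  A smooth substitute for \<open>s \<mapsto> min s a\<close>: the identity up to \<open>a\<close>, with values in \<open>(a, b]\<close> after
  \<open>a\<close>.
\<close>

lemma smooth_truncation:
  fixes a b :: real
  assumes "a < b"
  obtains \<tau> where "\<And>n. times_diff n \<tau>" "\<And>s. s \<le> a \<Longrightarrow> \<tau> s = s" "\<And>s. s > a \<Longrightarrow> a < \<tau> s" "\<And>s. s > a \<Longrightarrow> \<tau> s \<le> b"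
proof -
  define \<eta> where "\<eta> = b - a"
  have \<eta>: "\<eta> > 0" using assms by (simp add: \<eta>_def)
  \<comment> \<open>With this \<open>M\<close>, the denominator \<open>D s\<close> exceeds \<open>(s - a) / \<eta>\<close> once \<open>s - a > \<eta>\<close>.\<close>
  define M where "M = 1 / (\<eta> * flat 0 \<eta>)"
  have M: "M > 0" using \<eta> by (simp add: M_def flat_def)
  define D where "D s = 1 + M * ((s - a) * flat 0 (s - a))" for s
  have D: "D s \<ge> 1" for s using M by (simp add: D_def flat_def)
  define \<tau> where "\<tau> s = a + (s - a) / D s" for s
  have "times_diff n D" for n
    unfolding D_def by (intro times_diff_add times_diff_mult times_diff_diff times_diff_const times_diff_id
      times_diff_compose[OF times_diff_flat])
  moreover have D0: "D s \<noteq> 0" for s using D[of s] by simp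
  ultimately have "times_diff n \<tau>" for n
    unfolding \<tau>_def by (intro times_diff_add times_diff_divide times_diff_diff times_diff_const times_diff_id)
  moreover have "\<tau> s = s" if "s \<le> a" for s
    using that by (simp add: \<tau>_def D_def flat_def)
  moreover have "\<tau> s > a" if "s > a" for s
    using that D[of s] by (simp add: \<tau>_def)
  moreover have "\<tau> s \<le> b" if "s > a" for s
  proof -
    have "s - a \<le> \<eta> * D s"
    proof (cases "s - a \<le> \<eta>")
      case True
      have "\<eta> * 1 \<le> \<eta> * D s" using D[of s] \<eta> by (intro mult_left_mono) auto
      with True show ?thesis by simp
    next
      case False
      then have "flat 0 \<eta> \<le> flat 0 (s - a)" using \<eta> by (simp add: flat_def frac_le)
      moreover have "flat 0 \<eta> > 0" using \<eta> by (simp add: flat_def)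
      ultimately have "1 \<le> flat 0 (s - a) / flat 0 \<eta>" by simp
      then have "(s - a) * 1 \<le> (s - a) * (flat 0 (s - a) / flat 0 \<eta>)"
        using that by (intro mult_left_mono) auto
      also have "\<dots> = \<eta> * (M * ((s - a) * flat 0 (s - a)))" using \<eta> by (simp add: M_def)
      also have "\<dots> \<le> \<eta> * D s" using \<eta> by (simp add: D_def)
      finally show ?thesis by simp
    qed
    then have "(s - a) / D s \<le> \<eta>" using D[of s] by (simp add: divide_le_eq)
    then show ?thesis by (simp add: \<tau>_def \<eta>_def)
  qed
  ultimately show thesis by (rule that)
qed

lemma antiderivative_exists:
  fixes f :: "real \<Rightarrow> real"
  assumes "\<And>x. isCont f x"
  obtains F where "\<And>x. (F has_real_derivative f x) (at x)" "F 0 = c"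
proof -
  obtain F where F: "\<And>x. (F has_real_derivative f x) (at x)"
    using einterval_antiderivative[of "-\<infinity>" \<infinity> f] assms
    by (auto simp: has_real_derivative_iff_has_vector_derivative)
  then have "((\<lambda>x. F x - F 0 + c) has_real_derivative f x) (at x)" for x
    by (auto intro!: derivative_eq_intros)
  then show thesis by (rule that) simp
qed

lemma eq_of_deriv_eq:
  fixes f g :: "real \<Rightarrow> real"
  assumes "\<And>x. \<bar>x\<bar> < r \<Longrightarrow> (f has_real_derivative h x) (at x)"
    "\<And>x. \<bar>x\<bar> < r \<Longrightarrow> (g has_real_derivative h x) (at x)"
    and "f 0 = g 0" "\<bar>x\<bar> < r"
  shows "f x = g x"
proof -
  have "\<exists>c. \<forall>x\<in>{-r<..<r}. f x - g x = c"
  proof (rule has_field_derivative_zero_constant)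
    fix y assume "y \<in> {-r<..<r}"
    then have "\<bar>y\<bar> < r" by auto
    from DERIV_diff[OF assms(1)[OF this] assms(2)[OF this]]
    show "((\<lambda>x. f x - g x) has_real_derivative 0) (at y within {-r<..<r})"
      by (simp add: has_field_derivative_at_within)
  qed simp
  then obtain c where c: "\<And>x. \<bar>x\<bar> < r \<Longrightarrow> f x - g x = c"
    by (auto simp: abs_less_iff)
  from c[of 0] c[of x] assms(3,4) show ?thesis by simp
qed

section \<open>Convex extension of the profile\<close>

text \<open>
  The function \<open>F\<close> under the root in the profile \<open>u \<surd>(F(u\<^sup>2))\<close>.
\<close>

definition radicand :: "real \<Rightarrow> real \<Rightarrow> real" where
  "radicand c s = 1 + 7 * s - c * s\<^sup>2"

text \<open>
  The polynomial \<open>Q\<close> that decides the convexity of the profile, whose second derivative is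
  \<open>u Q(u\<^sup>2) / F(u\<^sup>2)\<^bsup>3/2\<^esup>\<close>.
\<close>

definition convexity_poly :: "real \<Rightarrow> real \<Rightarrow> real" where
  "convexity_poly c s = 21 + (98 - 10 * c) * s - 63 * c * s\<^sup>2 + 6 * c\<^sup>2 * s ^ 3"

lemma profile_deriv:
  assumes "radicand c (u\<^sup>2) > 0"
  shows "((\<lambda>u. u * sqrt (radicand c (u\<^sup>2))) has_real_derivative
      (1 + 14 * u\<^sup>2 - 3 * c * u ^ 4) / sqrt (radicand c (u\<^sup>2))) (at u)"
    and "((\<lambda>u. (1 + 14 * u\<^sup>2 - 3 * c * u ^ 4) / sqrt (radicand c (u\<^sup>2))) has_real_derivative
      u * convexity_poly c (u\<^sup>2) / sqrt (radicand c (u\<^sup>2)) ^ 3) (at u)"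
proof -
  define \<phi> where "\<phi> = sqrt (radicand c (u\<^sup>2))"
  have \<phi>: "\<phi> > 0" "\<phi>\<^sup>2 = 1 + 7 * u\<^sup>2 - c * u ^ 4"
    using assms by (auto simp: \<phi>_def radicand_def simp flip: power_mult)
  have "((\<lambda>u. radicand c (u\<^sup>2)) has_real_derivative 14 * u - 4 * c * u ^ 3) (at u)"
    unfolding radicand_def by (auto intro!: derivative_eq_intros simp: power2_eq_square power3_eq_cube)
  from DERIV_chain2[OF DERIV_real_sqrt[OF assms] this]
  have "((\<lambda>u. sqrt (radicand c (u\<^sup>2))) has_real_derivative
      inverse \<phi> / 2 * (14 * u - 4 * c * u ^ 3)) (at u)"
    by (simp only: \<phi>_def)
  moreover have "inverse \<phi> / 2 * (14 * u - 4 * c * u ^ 3) = (7 * u - 2 * c * u ^ 3) / \<phi>"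
    using \<phi>(1) by (simp add: field_simps)
  ultimately have d: "((\<lambda>u. sqrt (radicand c (u\<^sup>2))) has_real_derivative
      (7 * u - 2 * c * u ^ 3) / \<phi>) (at u)"
    by (simp only:)
  have "\<phi> + (7 * u - 2 * c * u ^ 3) / \<phi> * u = (1 + 14 * u\<^sup>2 - 3 * c * u ^ 4) / \<phi>"
    using \<phi> by (simp add: field_simps power2_eq_square power3_eq_cube) algebra
  with DERIV_mult[OF DERIV_ident d]
  show "((\<lambda>u. u * sqrt (radicand c (u\<^sup>2))) has_real_derivative
      (1 + 14 * u\<^sup>2 - 3 * c * u ^ 4) / sqrt (radicand c (u\<^sup>2))) (at u)"
    by (simp add: \<phi>_def)
  have n: "((\<lambda>u. 1 + 14 * u\<^sup>2 - 3 * c * u ^ 4) has_real_derivative 28 * u - 12 * c * u ^ 3) (at u)"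
    by (auto intro!: derivative_eq_intros)
  have "((28 * u - 12 * c * u ^ 3) * \<phi> - (1 + 14 * u\<^sup>2 - 3 * c * u ^ 4) * ((7 * u - 2 * c * u ^ 3) / \<phi>)) / (\<phi> * \<phi>)
      = ((28 * u - 12 * c * u ^ 3) * \<phi>\<^sup>2 - (1 + 14 * u\<^sup>2 - 3 * c * u ^ 4) * (7 * u - 2 * c * u ^ 3)) / \<phi> ^ 3"
    using \<phi>(1) by (simp add: field_simps power2_eq_square power3_eq_cube)
  also have "\<dots> = u * convexity_poly c (u\<^sup>2) / \<phi> ^ 3"
    unfolding \<phi>(2) convexity_poly_def by (simp add: algebra_simps eval_nat_numeral)
  finally show "((\<lambda>u. (1 + 14 * u\<^sup>2 - 3 * c * u ^ 4) / sqrt (radicand c (u\<^sup>2))) has_real_derivative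
      u * convexity_poly c (u\<^sup>2) / sqrt (radicand c (u\<^sup>2)) ^ 3) (at u)"
    using DERIV_divide[OF n d] \<phi>(1) by (simp add: \<phi>_def)
qed

text \<open>
  A smooth odd extension of the profile from a neighbourhood of \<open>[0, \<surd>s\<^sub>0]\<close>, convex on the
  half line.
\<close>

lemma convex_extension:
  fixes c s0 :: real
  assumes s0: "s0 > 0"
    and pos: "\<forall>s\<in>{0..s0}. radicand c s > 0 \<and> convexity_poly c s > 0"
  obtains r g g1 g2 where "r > sqrt s0" "C_infinity g" "\<And>u. g (- u) = - g u"
    "\<And>u. (g has_real_derivative g1 u) (at u)" "\<And>u. (g1 has_real_derivative g2 u) (at u)"
    "g1 0 = 1" "\<And>u. u > 0 \<Longrightarrow> g u > 0" "\<And>u. u > 0 \<Longrightarrow> g1 u > 1" "\<And>u. u > 0 \<Longrightarrow> g2 u > 0"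
    "\<And>u. \<bar>u\<bar> < r \<Longrightarrow> radicand c (u\<^sup>2) > 0 \<and> g u = u * sqrt (radicand c (u\<^sup>2))"
proof -
  have "isCont (radicand c) s0" "isCont (convexity_poly c) s0"
    unfolding radicand_def convexity_poly_def by (auto intro!: continuous_intros)
  then have "((\<lambda>s. min (radicand c s) (convexity_poly c s)) \<longlongrightarrow> min (radicand c s0) (convexity_poly c s0)) (at s0)"
    by (intro tendsto_min) (auto simp: isCont_def)
  moreover have "min (radicand c s0) (convexity_poly c s0) > 0" using pos s0 by simp
  ultimately have "eventually (\<lambda>s. min (radicand c s) (convexity_poly c s) > 0) (at s0)"
    by (rule order_tendstoD(1))
  then obtain \<delta> where \<delta>: "\<delta> > 0"
    "\<And>s. s \<noteq> s0 \<Longrightarrow> dist s s0 < \<delta> \<Longrightarrow> radicand c s > 0 \<and> convexity_poly c s > 0"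
    unfolding eventually_at by auto
  define a b where "a = s0 + \<delta> / 3" and "b = s0 + \<delta> / 2"
  have posb: "radicand c s > 0 \<and> convexity_poly c s > 0" if "0 \<le> s" "s \<le> b" for s
    using pos \<delta>(2)[of s] \<delta>(1) that by (cases "s \<le> s0") (auto simp: b_def dist_real_def)
  have ab: "s0 < a" "a < b" using \<delta>(1) by (auto simp: a_def b_def)
  obtain \<tau> where \<tau>: "\<And>n. times_diff n \<tau>" "\<And>s. s \<le> a \<Longrightarrow> \<tau> s = s"
    "\<And>s. s > a \<Longrightarrow> a < \<tau> s" "\<And>s. s > a \<Longrightarrow> \<tau> s \<le> b"
    using smooth_truncation[OF ab(2)] by metis
  have \<tau>_pos: "radicand c (\<tau> (u\<^sup>2)) > 0" "convexity_poly c (\<tau> (u\<^sup>2)) > 0" for u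
  proof -
    have "0 \<le> \<tau> (u\<^sup>2) \<and> \<tau> (u\<^sup>2) \<le> b"
      using \<tau>(2)[of "u\<^sup>2"] \<tau>(3)[of "u\<^sup>2"] \<tau>(4)[of "u\<^sup>2"] ab s0 by (cases "u\<^sup>2 \<le> a") auto
    with posb show "radicand c (\<tau> (u\<^sup>2)) > 0" "convexity_poly c (\<tau> (u\<^sup>2)) > 0" by auto
  qed
  \<comment> \<open>The second derivative of \<open>g\<close>: that of the profile as long as \<open>u\<^sup>2 \<le> a\<close>, and positive for
      all \<open>u > 0\<close>.\<close>
  define h where "h u = u * convexity_poly c (\<tau> (u\<^sup>2)) / sqrt (radicand c (\<tau> (u\<^sup>2))) ^ 3" for u
  have nz: "sqrt (radicand c (\<tau> (u\<^sup>2))) ^ 3 \<noteq> 0" for u using \<tau>_pos(1)[of u] by simp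
  have smooth_h: "times_diff n h" for n
  proof -
    have \<tau>_sq: "times_diff n (\<lambda>u. \<tau> (u\<^sup>2))"
      by (rule times_diff_compose[OF \<tau>(1) times_diff_power[OF times_diff_id]])
    have "times_diff n (radicand c)" "times_diff n (convexity_poly c)"
      unfolding radicand_def[abs_def] convexity_poly_def[abs_def]
      by (intro times_diff_add times_diff_diff times_diff_mult times_diff_power times_diff_const times_diff_id)+
    note this[THEN times_diff_compose, OF \<tau>_sq]
    then show ?thesis
      unfolding h_def using \<tau>_pos(1) nz
      by (intro times_diff_divide times_diff_mult times_diff_power times_diff_sqrt times_diff_id)
  qed
  obtain h' where "\<And>u. (h has_real_derivative h' u) (at u)"
    using smooth_h[of "Suc 0"] by auto
  then have cont_h: "isCont h u" for u by (rule DERIV_isCont)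
  have h_odd: "h (- u) = - h u" for u by (simp add: h_def)
  have h_pos: "h u > 0" if "u > 0" for u using \<tau>_pos[of u] that by (simp add: h_def)
  obtain g1 where g1: "\<And>u. (g1 has_real_derivative h u) (at u)" "g1 0 = 1"
    using antiderivative_exists[OF cont_h] by metis
  obtain g where g: "\<And>u. (g has_real_derivative g1 u) (at u)" "g 0 = 0"
    using antiderivative_exists[OF DERIV_isCont[OF g1(1)]] by metis
  have "times_diff n g1" for n
    using times_diff_SucI[OF g1(1) smooth_h] times_diff_SucD by blast
  then have "times_diff n g" for n
    using times_diff_SucI[OF g(1)] times_diff_SucD by blast
  then have smooth_g: "C_infinity g" by (rule C_infinityI)
  have refl_deriv: "((\<lambda>u. f (- u)) has_real_derivative - f' (- u)) (at u)"
    if "\<And>u. (f has_real_derivative f' u) (at u)" for f f' :: "real \<Rightarrow> real" and u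
    using DERIV_chain2[OF that DERIV_minus[OF DERIV_ident], of u] by simp
  have g1_even: "g1 (- u) = g1 u" for u
    by (rule eq_of_deriv_eq[where r = "\<bar>u\<bar> + 1" and f = "\<lambda>u. g1 (- u)" and g = g1 and h = h and x = u])
       (use refl_deriv[OF g1(1)] g1(1) in \<open>simp_all add: h_odd\<close>)
  have g_odd: "g (- u) = - g u" for u
    by (rule eq_of_deriv_eq[where r = "\<bar>u\<bar> + 1" and f = "\<lambda>u. g (- u)" and g = "\<lambda>u. - g u"
        and h = "\<lambda>u. - g1 u" and x = u])
       (use refl_deriv[OF g(1)] DERIV_minus[OF g(1)] g(2) in \<open>simp_all add: g1_even\<close>)
  have g1_gt: "g1 u > 1" if "u > 0" for u
  proof -
    have "g1 0 < g1 u"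
      by (rule DERIV_pos_imp_increasing_open[OF that])
         (use g1(1) h_pos in \<open>auto intro: DERIV_continuous_on has_field_derivative_at_within\<close>)
    then show ?thesis by (simp add: g1(2))
  qed
  have g_pos: "g u > 0" if "u > 0" for u
  proof -
    have "g 0 < g u"
    proof (rule DERIV_pos_imp_increasing_open[OF that])
      show "\<exists>y. (g has_real_derivative y) (at x) \<and> y > 0" if "0 < x" "x < u" for x
        using g(1)[of x] g1_gt[OF that(1)] by (intro exI[of _ "g1 x"]) simp
    qed (use g(1) in \<open>auto intro: DERIV_continuous_on has_field_derivative_at_within\<close>)
    then show ?thesis by (simp add: g(2))
  qed
  have sq: "u\<^sup>2 \<le> a" if "\<bar>u\<bar> < sqrt a" for u
    using power_mono[of "\<bar>u\<bar>" "sqrt a" 2] that ab s0 by simp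
  have posa: "radicand c (u\<^sup>2) > 0" if "\<bar>u\<bar> < sqrt a" for u
    using posb[of "u\<^sup>2"] sq[OF that] ab by simp
  have g1_eq: "g1 u = (1 + 14 * u\<^sup>2 - 3 * c * u ^ 4) / sqrt (radicand c (u\<^sup>2))" if "\<bar>u\<bar> < sqrt a" for u
  proof (rule eq_of_deriv_eq[where r = "sqrt a" and f = g1 and h = h and x = u
      and g = "\<lambda>u. (1 + 14 * u\<^sup>2 - 3 * c * u ^ 4) / sqrt (radicand c (u\<^sup>2))"])
    fix y assume y: "\<bar>y\<bar> < sqrt a"
    show "((\<lambda>u. (1 + 14 * u\<^sup>2 - 3 * c * u ^ 4) / sqrt (radicand c (u\<^sup>2))) has_real_derivative h y) (at y)"
      using profile_deriv(2)[OF posa[OF y]] \<tau>(2)[OF sq[OF y]] by (simp add: h_def)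
  qed (use g1 that in \<open>auto simp: radicand_def\<close>)
  have g_eq: "g u = u * sqrt (radicand c (u\<^sup>2))" if "\<bar>u\<bar> < sqrt a" for u
  proof (rule eq_of_deriv_eq[where r = "sqrt a" and f = g and h = g1 and x = u
      and g = "\<lambda>u. u * sqrt (radicand c (u\<^sup>2))"])
    fix y assume y: "\<bar>y\<bar> < sqrt a"
    show "((\<lambda>u. u * sqrt (radicand c (u\<^sup>2))) has_real_derivative g1 y) (at y)"
      using profile_deriv(1)[OF posa[OF y]] g1_eq[OF y] by simp
  qed (use g that in auto)
  show thesis
    by (rule that[of "sqrt a" g g1 h])
       (use ab s0 smooth_g g_odd g g1 g1_gt g_pos h_pos posa g_eq in auto)
qed

section \<open>Convexity up to the boundary radius\<close>

text \<open>
  Under the bounds on \<open>c\<close> and \<open>c s\<^sub>0\<close> the polynomial is decreasing on \<open>[0, s\<^sub>0]\<close>, so its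
  positivity at \<open>s\<^sub>0\<close> suffices.
\<close>

lemma convexity_poly_pos:
  fixes c s0 s :: real
  assumes c: "c \<ge> 14" and s0: "c * s0 \<le> 37 / 18" and Q: "convexity_poly c s0 > 0"
    and s: "0 \<le> s" "s \<le> s0"
  shows "radicand c s > 0 \<and> convexity_poly c s > 0"
proof
  define p q where "p = c * s" and "q = c * s0"
  have pq: "0 \<le> p" "p \<le> q" "q \<le> 37 / 18"
    using c s s0 by (auto simp: p_def q_def intro: mult_left_mono)
  have "p * s \<le> 37 / 18 * s" using pq s by (intro mult_right_mono) auto
  then show "radicand c s > 0" using s by (simp add: radicand_def p_def power2_eq_square)
  have k: "x * y \<le> 37 / 18 * y" if "x \<le> q" "0 \<le> y" for x y
    using that pq by (intro mult_right_mono) auto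
  have "6 * (p * p + p * q + q * q) \<le> 63 * (p + q)"
    using k[OF pq(2,1)] k[OF pq(2) order_trans[OF pq(1,2)]] k[OF order_refl order_trans[OF pq(1,2)]] pq
    by (simp add: algebra_simps)
  then have "0 \<le> (s0 - s) * ((10 * c - 98) + (63 * (p + q) - 6 * (p * p + p * q + q * q)))"
    using c s by (intro mult_nonneg_nonneg) auto
  also have "\<dots> = convexity_poly c s - convexity_poly c s0"
    by (simp add: convexity_poly_def p_def q_def power2_eq_square power3_eq_cube algebra_simps)
  finally show "convexity_poly c s > 0" using Q by simp
qed

text \<open>
  Explicitly, \<open>s\<^sub>0 = 2 / (S - 7 (d - 1))\<close> with \<open>S = \<surd>((46 d\<^sup>2 - 291 d - 49) (d - 1))\<close>. The bound
  \<open>37 / 18\<close> on \<open>c s\<^sub>0\<close> is attained at \<open>d = 9\<close>, the tightest case for the positivity of \<open>Q(s\<^sub>0)\<close>.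
\<close>

lemma phi0_one:
  fixes d :: nat
  assumes d: "d \<ge> 8"
  defines "c \<equiv> 23 * real d - 170"
  obtains s0 where "phi0 d 1 = sqrt s0" "s0 > 0" "c * s0 \<le> 37 / 18" "convexity_poly c s0 > 0"
proof -
  define x where "x = real d"
  define S where "S = sqrt ((46 * x\<^sup>2 - 291 * x - 49) * (x - 1))"
  define s0 where "s0 = 2 / (S - 7 * (x - 1))"
  have x: "x \<ge> 8" using d by (simp add: x_def)
  have main: "S - 7 * (x - 1) > 0 \<and> c * s0 \<le> 37 / 18 \<and> convexity_poly c s0 > 0"
  proof -
    consider "d = 8" | "d = 9" | "d \<ge> 10" using d by linarith
    then show ?thesis
    proof cases
      case 1
      then have "S = 63" by (simp add: S_def x_def real_sqrt_unique)
      then have v: "s0 = 1 / 7" "c = 14" "x = 8" using 1 by (auto simp: s0_def x_def c_def)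
      show ?thesis unfolding v \<open>S = 63\<close> by (simp add: convexity_poly_def power2_eq_square power3_eq_cube)
    next
      case 2
      then have "S = 92" by (simp add: S_def x_def real_sqrt_unique)
      then have v: "s0 = 1 / 18" "c = 37" "x = 9" using 2 by (auto simp: s0_def x_def c_def)
      show ?thesis unfolding v \<open>S = 92\<close> by (simp add: convexity_poly_def power2_eq_square power3_eq_cube)
    next
      case 3
      define e where "e = x - 10"
      have e: "e \<ge> 0" "x = e + 10" using 3 by (auto simp: e_def x_def)
      have c: "c = 23 * x - 170" "c \<ge> 60" using 3 by (auto simp: c_def x_def)
      \<comment> \<open>Equivalent to \<open>c s\<^sub>0 \<le> 37 / 18\<close>. The cubic behind it vanishes at \<open>x = 9\<close> and is
          negative right after, but its expansion at \<open>x = 10\<close> has positive coefficients.\<close>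
      have "7 * (x - 1) + 36 / 37 * c \<le> S"
        unfolding S_def
      proof (rule real_le_rsqrt)
        have "1369 * ((46 * x\<^sup>2 - 291 * x - 49) * (x - 1)) - 1369 * (7 * (x - 1) + 36 / 37 * c)\<^sup>2
          = 62974 * e ^ 3 + 246298 * e\<^sup>2 + 233004 * e + 49680"
          unfolding c e(2) by (simp add: power2_eq_square power3_eq_cube algebra_simps)
        also have "\<dots> \<ge> 0" using e(1) by simp
        finally show "(7 * (x - 1) + 36 / 37 * c)\<^sup>2 \<le> (46 * x\<^sup>2 - 291 * x - 49) * (x - 1)"
          by linarith
      qed
      then have D: "36 / 37 * c \<le> S - 7 * (x - 1)" by simp
      then have Dpos: "S - 7 * (x - 1) > 0" using c by linarith
      then have s0: "s0 > 0" by (simp add: s0_def)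
      have \<kappa>: "c * s0 \<le> 37 / 18" using D Dpos by (simp add: s0_def field_simps)
      have "60 * s0 \<le> c * s0" using c s0 by (intro mult_right_mono) auto
      then have s0': "s0 \<le> 1 / 25" using \<kappa> by linarith
      have "0 \<le> (37 / 18 - c * s0) * (63 - 6 * (c * s0 + 37 / 18))"
        using \<kappa> by (intro mult_nonneg_nonneg) auto
      also have "\<dots> = 6 * (c * s0)\<^sup>2 - 63 * (c * s0) + (63 * 37 / 18 - 6 * (37 / 18)\<^sup>2)"
        by (simp add: power2_eq_square algebra_simps)
      finally have "98 - 63 * (c * s0) + 6 * (c * s0)\<^sup>2 \<ge> - 7" by (simp add: power2_eq_square)
      then have "s0 * (98 - 63 * (c * s0) + 6 * (c * s0)\<^sup>2) \<ge> s0 * (- 7)"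
        using s0 by (intro mult_left_mono) auto
      then have "21 - 10 * (c * s0) + s0 * (98 - 63 * (c * s0) + 6 * (c * s0)\<^sup>2) > 0"
        using \<kappa> s0' by linarith
      also have "21 - 10 * (c * s0) + s0 * (98 - 63 * (c * s0) + 6 * (c * s0)\<^sup>2) = convexity_poly c s0"
        by (simp add: convexity_poly_def power2_eq_square power3_eq_cube algebra_simps)
      finally show ?thesis using \<kappa> Dpos by simp
    qed
  qed
  then have D: "S - 7 * (x - 1) > 0" by simp
  have E: "E_const d = S + 7 * (x - 1)" by (simp add: E_const_def S_def x_def)
  have Epos: "E_const d > 0" using D x unfolding E by (simp add: algebra_simps)
  have b: "b_const d - 1 = x * (S - 7 * (x - 1)) / (2 * E_const d)"
    using Epos unfolding b_const_def x_def[symmetric] by (simp add: field_simps) (simp add: E algebra_simps)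
  have "(x / e) / (x * D / (2 * e)) = 2 / D" if "e > 0" "D > 0" for e D
    using that x by (simp add: field_simps)
  then have "(x / E_const d) / (b_const d - 1) = s0"
    unfolding b s0_def using Epos D by blast
  then have "phi0 d 1 = sqrt s0"
    by (simp add: phi0_def a_const_def x_def flip: real_sqrt_divide)
  then show thesis using main D that[of s0] by (simp add: s0_def)
qed

section \<open>Existence of the warped product\<close>

theorem proposition2p1:
  fixes d :: nat
  assumes "d \<ge> 8" and "CARD('n::finite) = d"
  shows "\<exists>\<epsilon>>0. \<exists>g :: real \<Rightarrow> real.
           C_infinity g \<and> (\<forall>u. g (- u) = - g u) \<and> deriv g 0 = 1 \<and> (\<forall>u>0. g u > 0) \<and>
           (\<forall>u. \<bar>u\<bar> < phi0 d 1 + \<epsilon> \<longrightarrow>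
              g u = u * sqrt (1 + 7 * u\<^sup>2 - (23 * real d - 170) * u ^ 4)) \<and>
           negative_sectional_curvature (warped_metric g :: 'n metric_field)"
proof -
  define c where "c = 23 * real d - 170"
  have c: "c \<ge> 14" using assms(1) by (simp add: c_def)
  obtain s0 where s0: "phi0 d 1 = sqrt s0" "s0 > 0" "c * s0 \<le> 37 / 18" "convexity_poly c s0 > 0"
    using phi0_one[OF assms(1), folded c_def] by blast
  have pos: "\<forall>s\<in>{0..s0}. radicand c s > 0 \<and> convexity_poly c s > 0"
    using convexity_poly_pos[OF c s0(3,4)] by simp
  obtain r g g1 g2 where g: "r > sqrt s0" "C_infinity g" "\<And>u. g (- u) = - g u"
    "\<And>u. (g has_real_derivative g1 u) (at u)" "\<And>u. (g1 has_real_derivative g2 u) (at u)"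
    "g1 0 = 1" "\<And>u. u > 0 \<Longrightarrow> g u > 0" "\<And>u. u > 0 \<Longrightarrow> g1 u > 1" "\<And>u. u > 0 \<Longrightarrow> g2 u > 0"
    "\<And>u. \<bar>u\<bar> < r \<Longrightarrow> radicand c (u\<^sup>2) > 0 \<and> g u = u * sqrt (radicand c (u\<^sup>2))"
    by (rule convex_extension[OF s0(2) pos]) (rule that)
  have rad: "radicand c (u\<^sup>2) = 1 + 7 * u\<^sup>2 - c * u ^ 4" for u
    by (simp add: radicand_def flip: power_mult)
  have "negative_sectional_curvature (warped_metric g :: 'n metric_field)"
  proof (rule warped_metric_negative[OF g(4,5,7,8,9)])
    show "r > 0" using g(1) s0(2) by (meson less_trans real_sqrt_gt_zero)
    show "(g u)\<^sup>2 = u\<^sup>2 * (1 - u\<^sup>2 * (- 7 + c * u\<^sup>2))" if "0 < u" "u < r" for u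
    proof -
      have "(g u)\<^sup>2 = u\<^sup>2 * radicand c (u\<^sup>2)"
        using g(10)[of u] that by (simp add: power_mult_distrib)
      then show ?thesis by (simp add: radicand_def power2_eq_square algebra_simps)
    qed
  qed auto
  moreover have "deriv g 0 = 1" using DERIV_imp_deriv[OF g(4), of 0] g(6) by simp
  moreover have "g u = u * sqrt (1 + 7 * u\<^sup>2 - c * u ^ 4)" if "\<bar>u\<bar> < phi0 d 1 + (r - sqrt s0)" for u
    using g(10)[of u] that by (simp add: s0(1) rad)
  ultimately show ?thesis
    unfolding c_def[symmetric] using g(1,2,3,7) by (intro exI[of _ "r - sqrt s0"] conjI exI[of _ g]) auto
qed

end
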